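(* Let $\mathcal{H}$ be a complex Hilbert space, let $\alpha,\beta$ be real numbers with $0\leq\alpha\leq 1\leq\beta$, let $T\in B(\mathcal{H})$ be an $(\alpha,\beta)$-normal operator, let $r\geq 0$ be a real number, and let $\lambda\in\mathbb{C}\setminus\{0\}$. If $\|\lambda T^{*}-T\|\leq r$ and $\frac{r}{|\lambda|}\leq\inf\{\|T^{*}x\| : x\in\mathcal{H},\ \|x\|=1\}$, then $$\alpha^{2}\|T\|^{4}\leq w(T^{2})^{2}+\frac{r^{2}}{|\lambda|^{2}}\|T\|^{2}.$$
   Context: $B(\mathcal{H})$ denotes the algebra of bounded linear operators on the complex Hilbert space $(\mathcal{H};\langle\cdot,\cdot\rangle)$, and $\|\cdot\|$ denotes the operator norm (or the vector norm, when applied to vectors). For real numbers $0\leq\alpha\leq 1\leq\beta$, an operator $T\in B(\mathcal{H})$ is called $(\alpha,\beta)$-normal if $\alpha^{2}T^{*}T\leq TT^{*}\leq\beta^{2}T^{*}T$ in the usual (Loewner) order of self-adjoint operators. The numerical radius of $T\in B(\mathcal{H})$ is $w(T)=\sup\{|\langle Tx,x\rangle| : x\in\mathcal{H},\ \|x\|=1\}$. *)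

theory Defs
  imports "HOL-Analysis.Analysis"
begin

text \<open>
  A complex inner product space is a complex vector space with a sesquilinear form
  \<open>cinner\<close>, linear in the first and conjugate-linear in the second argument.
  The class extends \<open>real_inner\<close>, the real inner product being the real part of the
  complex one.  Hence \<open>norm x = sqrt (Re (cinner x x))\<close>, the form is positive definite, and
  the topology, completeness and \<open>onorm\<close> are those of the library.
\<close>

class complex_inner = real_inner +
  fixes scaleC :: "complex \<Rightarrow> 'a \<Rightarrow> 'a" (infixr "*\<^sub>C" 75)
    and cinner :: "'a \<Rightarrow> 'a \<Rightarrow> complex"
  assumes scaleC_add_right: "c *\<^sub>C (x + y) = c *\<^sub>C x + c *\<^sub>C y"
    and scaleC_add_left: "(c + d) *\<^sub>C x = c *\<^sub>C x + d *\<^sub>C x"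
    and scaleC_scaleC: "c *\<^sub>C d *\<^sub>C x = (c * d) *\<^sub>C x"
    and scaleC_of_real: "complex_of_real s *\<^sub>C x = s *\<^sub>R x"
    and cinner_commute: "cinner x y = cnj (cinner y x)"
    and cinner_add_left: "cinner (x + y) z = cinner x z + cinner y z"
    and cinner_scaleC_left: "cinner (c *\<^sub>C x) y = c * cinner x y"
    and inner_eq_Re_cinner: "inner x y = Re (cinner x y)"

class complex_hilbert = complex_inner + complete_space

lemma norm_eq_sqrt_cinner: "norm (x :: 'a::complex_inner) = sqrt (Re (cinner x x))"
  by (simp add: norm_eq_sqrt_inner inner_eq_Re_cinner)

instantiation complex :: complex_hilbert
begin

definition scaleC_complex :: "complex \<Rightarrow> complex \<Rightarrow> complex"
  where "scaleC_complex c x = c * x"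

definition cinner_complex :: "complex \<Rightarrow> complex \<Rightarrow> complex"
  where "cinner_complex x y = x * cnj y"

instance
  by standard
    (simp_all add: scaleC_complex_def cinner_complex_def inner_complex_def
      scaleR_conv_of_real algebra_simps)

end

definition bounded_clinear :: "('a::complex_inner \<Rightarrow> 'a) \<Rightarrow> bool"
  where "bounded_clinear T \<longleftrightarrow>
    bounded_linear T \<and> (\<forall>c x. T (c *\<^sub>C x) = c *\<^sub>C T x)"

text \<open>
  On a Hilbert space the adjoint of a bounded operator exists by the Riesz representation
  theorem; it is unique because \<open>cinner\<close> is definite.
\<close>

definition cadjoint :: "('a::complex_hilbert \<Rightarrow> 'a) \<Rightarrow> 'a \<Rightarrow> 'a"
  where "cadjoint T = (THE S. \<forall>x y. cinner (T x) y = cinner x (S y))"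

definition selfadjoint :: "('a::complex_hilbert \<Rightarrow> 'a) \<Rightarrow> bool"
  where "selfadjoint A \<longleftrightarrow> bounded_clinear A \<and> cadjoint A = A"

definition loewner_le :: "('a::complex_hilbert \<Rightarrow> 'a) \<Rightarrow> ('a \<Rightarrow> 'a) \<Rightarrow> bool"
  where "loewner_le A B \<longleftrightarrow> selfadjoint A \<and> selfadjoint B \<and>
    (\<forall>x. cinner (B x - A x) x \<in> \<real> \<and> 0 \<le> Re (cinner (B x - A x) x))"

definition alpha_beta_normal :: "real \<Rightarrow> real \<Rightarrow> ('a::complex_hilbert \<Rightarrow> 'a) \<Rightarrow> bool"
  where "alpha_beta_normal \<alpha> \<beta> T \<longleftrightarrow>
    loewner_le (\<lambda>x. \<alpha>\<^sup>2 *\<^sub>R cadjoint T (T x)) (\<lambda>x. T (cadjoint T x)) \<and>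
    loewner_le (\<lambda>x. T (cadjoint T x)) (\<lambda>x. \<beta>\<^sup>2 *\<^sub>R cadjoint T (T x))"

text \<open>On the zero space there are no unit vectors, and \<open>numerical_radius\<close> is unspecified.\<close>

definition numerical_radius :: "('a::complex_inner \<Rightarrow> 'a) \<Rightarrow> real"
  where "numerical_radius T = (SUP x\<in>{x. norm x = 1}. cmod (cinner (T x) x))"

end

theory Submission
  imports Defs
begin

text \<open>
  For vectors \<open>a\<close>, \<open>y\<close> the distance from \<open>a\<close> to the line through \<open>y\<close> is at most \<open>norm (a - y)\<close>, so
  \<open>(norm a)\<^sup>2 * (norm y)\<^sup>2 \<le> (a \<bullet> y)\<^sup>2 + (norm (a - y))\<^sup>2 * (norm y)\<^sup>2\<close>.
  Take \<open>a = l *\<^sub>C T\<^sup>* x\<close> and \<open>y = T x\<close> for a unit vector \<open>x\<close>: then \<open>a \<bullet> y\<close> is controlled by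
  \<open>\<langle>T\<^sup>2 x, x\<rangle>\<close>, while \<open>(\<alpha>, \<beta>)\<close>-normality gives \<open>\<alpha> * norm (T x) \<le> norm (T\<^sup>* x)\<close>.
  The supremum over \<open>x\<close> yields the claim.
\<close>

text \<open>The representing vector is the minimiser of \<open>(norm x)\<^sup>2 - 2 * f x\<close>; by the parallelogram law
  every minimising sequence is Cauchy.\<close>

lemma riesz_representation:
  fixes f :: "'a::{real_inner, complete_space} \<Rightarrow> real"
  assumes "bounded_linear f"
  obtains z where "\<And>x. f x = x \<bullet> z"
proof -
  interpret f: bounded_linear f by fact
  define J where "J x = (norm x)\<^sup>2 - 2 * f x" for x
  obtain K where K: "\<And>x. norm (f x) \<le> norm x * K"
    using f.bounded by blast
  \<comment> \<open>Completing the square: \<open>J x\<close> is at least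
    \<open>(norm x)\<^sup>2 - 2 * K * norm x\<close>, so the infimum below is over a bounded
    set.\<close>
  have J_ge: "- K\<^sup>2 \<le> J x" for x
  proof -
    have "0 \<le> (norm x - K)\<^sup>2" by simp
    moreover have "f x \<le> norm x * K" using K[of x] by simp
    ultimately show ?thesis by (simp add: J_def power2_diff)
  qed
  define m where "m = (INF x. J x)"
  have bdd: "bdd_below (range J)" using J_ge by (rule bdd_belowI2)
  have m_le: "m \<le> J x" for x unfolding m_def by (rule cINF_lower[OF bdd]) simp
  have "\<exists>x. J x < m + 1 / real (Suc n)" for n
  proof -
    have "(INF x. J x) < m + 1 / real (Suc n)" by (simp add: m_def)
    then show ?thesis by (subst (asm) cINF_less_iff[OF _ bdd]) auto
  qed
  then obtain X where X: "\<And>n. J (X n) < m + 1 / real (Suc n)" by metis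
  \<comment> \<open>The parallelogram law; the linear terms cancel. As the midpoint has
    \<open>J\<close> at least \<open>m\<close>, two points with \<open>J\<close> below
    \<open>m + e\<^sup>2 / 4\<close> are closer than \<open>e\<close>.\<close>
  have mid: "(norm (x - y))\<^sup>2 = 2 * J x + 2 * J y - 4 * J ((1/2) *\<^sub>R (x + y))" for x y
    by (simp add: J_def f.add f.scaleR power_mult_distrib power2_norm_eq_inner
        inner_simps inner_commute field_simps)
  have "Cauchy X"
  proof (rule metric_CauchyI)
    fix e :: real assume "0 < e"
    then obtain N where N: "inverse (real (Suc N)) < e\<^sup>2 / 4"
      using reals_Archimedean[of "e\<^sup>2 / 4"] by auto
    have "dist (X p) (X q) < e" if "p \<ge> N" "q \<ge> N" for p q
    proof -
      have *: "J (X p) < m + e\<^sup>2 / 4" if "p \<ge> N" for p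
      proof -
        have "1 / real (Suc p) \<le> inverse (real (Suc N))"
          using that by (simp add: field_simps)
        with X[of p] N show ?thesis by linarith
      qed
      have "(norm (X p - X q))\<^sup>2 < e\<^sup>2"
        using mid[of "X p" "X q"] *[OF that(1)] *[OF that(2)]
          m_le[of "(1/2) *\<^sub>R (X p + X q)"] by linarith
      then show ?thesis
        using \<open>0 < e\<close> by (simp add: dist_norm power_less_imp_less_base)
    qed
    then show "\<exists>M. \<forall>p\<ge>M. \<forall>q\<ge>M. dist (X p) (X q) < e" by blast
  qed
  then obtain z where z: "X \<longlonglongrightarrow> z"
    using Cauchy_convergent convergent_def by blast
  have "(\<lambda>n. J (X n)) \<longlonglongrightarrow> J z"
    unfolding J_def by (intro tendsto_intros f.tendsto z)
  moreover have "(\<lambda>n. m + 1 / real (Suc n)) \<longlonglongrightarrow> m + 0"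
    using LIMSEQ_inverse_real_of_nat by (intro tendsto_intros) (simp add: inverse_eq_divide)
  ultimately have "J z \<le> m + 0"
    by (rule LIMSEQ_le) (use X less_imp_le in blast)
  then have min: "J z \<le> J x" for x using m_le[of x] by simp
  have "f h = h \<bullet> z" for h
  proof (rule ccontr)
    assume neq: "f h \<noteq> h \<bullet> z"
    define d where "d = f h - h \<bullet> z"
    have nz: "d \<noteq> 0" using neq by (simp add: d_def)
    \<comment> \<open>Minimality of \<open>z\<close> along the line in direction \<open>h\<close>.
      The choice of \<open>t\<close> below minimises the quadratic and forces
      \<open>d = 0\<close>.\<close>
    have var: "2 * t * d \<le> t\<^sup>2 * (norm h)\<^sup>2" for t
      using min[of "z + t *\<^sub>R h"]
      unfolding J_def d_def power2_norm_eq_inner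
      by (simp add: f.add f.scaleR inner_simps inner_commute power2_eq_square algebra_simps)
    have h: "h \<noteq> 0" using neq by (auto simp: f.zero)
    show False
      using var[of "d / (norm h)\<^sup>2"] nz h
      by (auto simp: field_simps power2_eq_square mult_le_0_iff)
  qed
  then show thesis using that by blast
qed

context complex_inner
begin

lemma cinner_scaleC_right: "cinner x (c *\<^sub>C y) = cnj c * cinner x y"
  using cinner_commute cinner_scaleC_left complex_cnj_mult by metis

text \<open>Replacing \<open>x\<close> by \<open>\<i> *\<^sub>C x\<close> turns imaginary parts into
  real parts up to sign. This lifts the real Riesz representation to the complex form.\<close>

lemma cinner_eqI_Re:
  assumes "\<And>x. Re (cinner (F x) y) = Re (cinner x z)" and "\<And>x. F (\<i> *\<^sub>C x) = \<i> *\<^sub>C F x"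
  shows "cinner (F x) y = cinner x z"
proof (rule complex_eqI)
  show "Im (cinner (F x) y) = Im (cinner x z)"
    using assms(1)[of "\<i> *\<^sub>C x"] by (simp add: assms(2) cinner_scaleC_left)
qed (rule assms)

end

lemma norm_scaleC: "norm (c *\<^sub>C x) = cmod c * norm (x :: 'a::complex_inner)"
proof -
  have "cinner (c *\<^sub>C x) (c *\<^sub>C x) = of_real ((cmod c)\<^sup>2) * cinner x x"
    by (simp only: complex_norm_square cinner_scaleC_left cinner_scaleC_right mult_ac)
  then have "(norm (c *\<^sub>C x))\<^sup>2 = (cmod c * norm x)\<^sup>2"
    by (simp add: power2_norm_eq_inner inner_eq_Re_cinner power_mult_distrib del: of_real_power)
  then show ?thesis by simp
qed

text \<open>A unimodular factor \<open>u\<close> rotates the form to a nonnegative real, which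
  reduces the claim to the real Cauchy-Schwarz inequality.\<close>

lemma cmod_cinner_le: "cmod (cinner x y) \<le> norm x * norm (y :: 'a::complex_inner)"
proof (cases "cinner x y = 0")
  case False
  define u where "u = cnj (cinner x y) / cmod (cinner x y)"
  have u: "cmod u = 1" using False by (simp add: u_def norm_divide)
  have "u * cinner x y = cmod (cinner x y)"
    using False complex_norm_square[of "cinner x y"]
    by (simp add: u_def field_simps power2_eq_square)
  then have "cmod (cinner x y) = (u *\<^sub>C x) \<bullet> y"
    by (simp add: inner_eq_Re_cinner cinner_scaleC_left)
  also have "\<dots> \<le> norm (u *\<^sub>C x) * norm y" by (rule norm_cauchy_schwarz)
  finally show ?thesis by (simp add: norm_scaleC u)
qed simp

text \<open>The description defining \<open>cadjoint\<close> has meaning only once existence and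
  uniqueness are known: Riesz gives the first, definiteness the second.\<close>

lemma cinner_cadjoint:
  assumes "bounded_clinear T"
  shows "cinner (T x) y = cinner x (cadjoint T y)"
proof -
  have T: "bounded_linear T" and TC: "\<And>c x. T (c *\<^sub>C x) = c *\<^sub>C T x"
    using assms by (auto simp: bounded_clinear_def)
  have "\<exists>z. \<forall>x. cinner (T x) y = cinner x z" for y
  proof -
    have "bounded_linear (\<lambda>x. T x \<bullet> y)"
      by (rule bounded_linear_compose[OF bounded_linear_inner_left T])
    then obtain z where z: "\<And>x. T x \<bullet> y = x \<bullet> z"
      using riesz_representation[of "\<lambda>x. T x \<bullet> y"] by blast
    have "cinner (T x) y = cinner x z" for x
      by (rule cinner_eqI_Re) (use z in \<open>simp_all add: TC inner_eq_Re_cinner\<close>)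
    then show ?thesis by blast
  qed
  then obtain S where S: "\<forall>x y. cinner (T x) y = cinner x (S y)" by metis
  have "S' = S" if S': "\<forall>x y. cinner (T x) y = cinner x (S' y)" for S'
  proof
    fix y
    have "x \<bullet> S' y = x \<bullet> S y" for x using S S' by (simp add: inner_eq_Re_cinner)
    then show "S' y = S y" using vector_eq_ldot by blast
  qed
  with S have "\<forall>x y. cinner (T x) y = cinner x (cadjoint T y)"
    unfolding cadjoint_def by (rule theI)
  then show ?thesis by blast
qed

lemma bounded_linear_cadjoint:
  assumes "bounded_clinear T"
  shows "bounded_linear (cadjoint T)"
proof -
  have adj: "x \<bullet> cadjoint T y = T x \<bullet> y" for x y
    by (simp add: inner_eq_Re_cinner cinner_cadjoint[OF assms])
  have T: "bounded_linear T" using assms by (simp add: bounded_clinear_def)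
  show ?thesis
  proof (rule bounded_linear_intro)
    show "cadjoint T (x + y) = cadjoint T x + cadjoint T y" for x y
      by (subst vector_eq_ldot[symmetric]) (simp add: adj inner_simps)
    show "cadjoint T (c *\<^sub>R x) = c *\<^sub>R cadjoint T x" for c x
      by (subst vector_eq_ldot[symmetric]) (simp add: adj inner_simps)
    show "norm (cadjoint T y) \<le> norm y * onorm T" for y
    proof (cases "cadjoint T y = 0")
      case False
      \<comment> \<open>One factor \<open>norm (cadjoint T y)\<close> is cancelled at the end, hence
        the case split.\<close>
      have "norm (cadjoint T y) * norm (cadjoint T y) = T (cadjoint T y) \<bullet> y"
        by (metis adj power2_eq_square power2_norm_eq_inner)
      also have "\<dots> \<le> norm (T (cadjoint T y)) * norm y" by (rule norm_cauchy_schwarz)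
      also have "\<dots> \<le> onorm T * norm (cadjoint T y) * norm y"
        by (intro mult_right_mono onorm[OF T]) simp
      finally show ?thesis using False by (simp add: mult_ac)
    qed (simp add: onorm_pos_le[OF T])
  qed
qed

lemma bounded_linear_scaleC: "bounded_linear (\<lambda>x :: 'a::complex_inner. c *\<^sub>C x)"
proof (rule bounded_linear_intro)
  show "c *\<^sub>C (s *\<^sub>R x) = s *\<^sub>R (c *\<^sub>C x)" for s and x :: 'a
    by (simp add: scaleC_scaleC mult.commute flip: scaleC_of_real)
  show "norm (c *\<^sub>C x) \<le> norm x * cmod c" for x :: 'a
    by (simp add: norm_scaleC mult.commute)
qed (rule scaleC_add_right)

lemma cmod_cinner_le_numerical_radius:
  assumes "bounded_linear T" and "norm x = 1"
  shows "cmod (cinner (T x) x) \<le> numerical_radius T"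
  unfolding numerical_radius_def
proof (rule cSUP_upper)
  \<comment> \<open>A real supremum dominates its members only if the set is bounded above;
    Cauchy-Schwarz gives the bound \<open>onorm T\<close>.\<close>
  show "bdd_above ((\<lambda>x. cmod (cinner (T x) x)) ` {x. norm x = 1})"
  proof (rule bdd_aboveI2)
    fix x :: 'a assume "x \<in> {x. norm x = 1}"
    then show "cmod (cinner (T x) x) \<le> onorm T"
      using cmod_cinner_le[of "T x" x] onorm[OF assms(1), of x] by simp
  qed
qed (use assms(2) in simp)

lemma alpha_beta_normal_norm_le:
  assumes "bounded_clinear T" and "alpha_beta_normal \<alpha> \<beta> T"
  shows "\<alpha>\<^sup>2 * (norm (T x))\<^sup>2 \<le> (norm (cadjoint T x))\<^sup>2"
proof -
  have adj: "T x \<bullet> y = x \<bullet> cadjoint T y" for x y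
    by (simp add: inner_eq_Re_cinner cinner_cadjoint[OF assms(1)])
  \<comment> \<open>The lower Loewner bound as a quadratic form; moving the adjoints across turns
    both terms into squared norms.\<close>
  have "0 \<le> (T (cadjoint T x) - \<alpha>\<^sup>2 *\<^sub>R cadjoint T (T x)) \<bullet> x"
    using assms(2) by (simp add: alpha_beta_normal_def loewner_le_def inner_eq_Re_cinner)
  also have "\<dots> = (norm (cadjoint T x))\<^sup>2 - \<alpha>\<^sup>2 * (norm (T x))\<^sup>2"
    using adj[of x "T x"] adj[of "cadjoint T x" x]
    by (simp add: inner_diff_left power2_norm_eq_inner inner_commute[of _ x] inner_diff_right)
  finally show ?thesis by simp
qed

lemma norm_mult_le_inner_plus_dist:
  fixes a y :: "'a::real_inner"
  shows "(norm a)\<^sup>2 * (norm y)\<^sup>2 \<le> (a \<bullet> y)\<^sup>2 + (norm (a - y))\<^sup>2 * (norm y)\<^sup>2"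
proof -
  \<comment> \<open>This square is exactly the right side minus the left side.\<close>
  have "0 \<le> (y \<bullet> y - a \<bullet> y)\<^sup>2" by simp
  then show ?thesis
    unfolding power2_norm_eq_inner
    by (simp add: inner_simps inner_commute power2_eq_square algebra_simps)
qed

theorem theorem2p5:
  fixes T :: "'a::complex_hilbert \<Rightarrow> 'a"
    and \<alpha> \<beta> r :: real
    and l :: complex
  assumes "0 \<le> \<alpha>" and "\<alpha> \<le> 1" and "1 \<le> \<beta>"
    and "bounded_clinear T"
    and "alpha_beta_normal \<alpha> \<beta> T"
    and "0 \<le> r"
    and "l \<noteq> 0"
    and "onorm (\<lambda>x. l *\<^sub>C cadjoint T x - T x) \<le> r"
    and "r / cmod l \<le> (INF x\<in>{x. norm x = 1}. norm (cadjoint T x))"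
  shows "\<alpha>\<^sup>2 * onorm T ^ 4 \<le>
    (numerical_radius (T \<circ> T))\<^sup>2 + r\<^sup>2 / (cmod l)\<^sup>2 * (onorm T)\<^sup>2"
proof -
  let ?C = "(numerical_radius (T \<circ> T))\<^sup>2 + r\<^sup>2 / (cmod l)\<^sup>2 * (onorm T)\<^sup>2"
  have T: "bounded_linear T" using assms(4) by (simp add: bounded_clinear_def)
  have TT: "bounded_linear (T \<circ> T)" using bounded_linear_compose[OF T T] by (simp add: o_def)
  have D: "bounded_linear (\<lambda>x. l *\<^sub>C cadjoint T x - T x)"
    by (intro bounded_linear_sub T bounded_linear_compose[OF bounded_linear_scaleC]
        bounded_linear_cadjoint assms(4))
  \<comment> \<open>Squares make this hold even on the zero space, where
    \<open>numerical_radius\<close> is unspecified.\<close>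
  have C: "0 \<le> ?C" by simp
  have unit: "\<alpha>\<^sup>2 * norm (T x) ^ 4 \<le> ?C" if x: "norm x = 1" for x
  proof -
    let ?a = "norm (cadjoint T x)" and ?b = "norm (T x)"
    let ?w = "numerical_radius (T \<circ> T)"
    have "norm (l *\<^sub>C cadjoint T x - T x) \<le> r"
      using onorm[OF D, of x] assms(8) x by simp
    then have dist: "(norm (l *\<^sub>C cadjoint T x - T x))\<^sup>2 \<le> r\<^sup>2"
      by (simp add: power_mono)
    have "\<bar>(l *\<^sub>C cadjoint T x) \<bullet> T x\<bar> \<le> cmod (cinner (T x) (l *\<^sub>C cadjoint T x))"
      by (metis abs_Re_le_cmod inner_commute inner_eq_Re_cinner)
    \<comment> \<open>Moving \<open>cadjoint T\<close> to the other side produces the second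
      \<open>T\<close>; this is how the numerical radius of the square enters.\<close>
    also have "\<dots> = cmod l * cmod (cinner ((T \<circ> T) x) x)"
      by (simp add: cinner_scaleC_right norm_mult cinner_cadjoint[OF assms(4), of "T x"])
    also have "\<dots> \<le> cmod l * ?w"
      by (intro mult_left_mono cmod_cinner_le_numerical_radius TT x) simp
    finally have "\<bar>(l *\<^sub>C cadjoint T x) \<bullet> T x\<bar> \<le> cmod l * ?w" .
    then have inner: "((l *\<^sub>C cadjoint T x) \<bullet> T x)\<^sup>2 \<le> (cmod l * ?w)\<^sup>2"
      using power_mono[of _ _ 2] by fastforce
    have b: "?b\<^sup>2 \<le> (onorm T)\<^sup>2" using onorm[OF T, of x] x by (simp add: power_mono)
    have "(cmod l)\<^sup>2 * (?a\<^sup>2 * ?b\<^sup>2) = (norm (l *\<^sub>C cadjoint T x))\<^sup>2 * ?b\<^sup>2"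
      by (simp add: norm_scaleC power_mult_distrib)
    also have "\<dots> \<le> ((l *\<^sub>C cadjoint T x) \<bullet> T x)\<^sup>2
        + (norm (l *\<^sub>C cadjoint T x - T x))\<^sup>2 * ?b\<^sup>2"
      by (rule norm_mult_le_inner_plus_dist)
    also have "\<dots> \<le> (cmod l * ?w)\<^sup>2 + r\<^sup>2 * (onorm T)\<^sup>2"
      by (intro add_mono inner mult_mono dist b) simp_all
    also have "\<dots> = (cmod l)\<^sup>2 * ?C"
      using assms(7) by (simp add: field_simps)
    finally have "?a\<^sup>2 * ?b\<^sup>2 \<le> ?C" using assms(7) by simp
    moreover have "\<alpha>\<^sup>2 * ?b ^ 4 \<le> ?a\<^sup>2 * ?b\<^sup>2"
      using mult_right_mono[OF alpha_beta_normal_norm_le[OF assms(4,5), of x], of "?b\<^sup>2"]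
      by (simp add: power2_eq_square power4_eq_xxxx mult_ac)
    ultimately show ?thesis by linarith
  qed
  show ?thesis
  proof (cases "\<alpha> = 0")
    case True
    with C show ?thesis by simp
  next
    case False
    \<comment> \<open>\<open>M\<close> is the bound on \<open>norm (T x)\<close> that
      \<open>unit\<close> gives for unit vectors. Homogeneity extends it to all \<open>x\<close>, so
      it bounds \<open>onorm T\<close>.\<close>
    define M where "M = root 4 (?C / \<alpha>\<^sup>2)"
    have M: "0 \<le> M" "M ^ 4 = ?C / \<alpha>\<^sup>2" using C by (simp_all add: M_def)
    have "norm (T x) \<le> M * norm x" for x
    proof (cases "x = 0")
      case False
      have "norm (T (x /\<^sub>R norm x)) ^ 4 \<le> M ^ 4"
        using unit[of "x /\<^sub>R norm x"] False \<open>\<alpha> \<noteq> 0\<close> by (simp add: M(2) field_simps)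
      then have "norm (T (x /\<^sub>R norm x)) \<le> M" using M(1) by (simp add: power_mono_iff)
      then show ?thesis
        using False by (simp add: linear_scale[OF bounded_linear.linear[OF T]] field_simps)
    qed (simp add: linear_0[OF bounded_linear.linear[OF T]])
    then have "onorm T \<le> M" using M(1) by (intro onorm_bound)
    then have "onorm T ^ 4 \<le> ?C / \<alpha>\<^sup>2"
      using power_mono[OF _ onorm_pos_le[OF T], of M 4] M(2) by simp
    then show ?thesis using False by (simp add: field_simps)
  qed
qed

end
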